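(* $B\subseteq REL\circ FTA\circ HOM$ and $LB\subseteq REL\circ FTA\circ LHOM$; that is, every bottom-up (resp. linear bottom-up) tree transformation is the composition of a relabeling, followed by a finite tree automaton restriction, followed by a tree homomorphism (resp. linear tree homomorphism).
   Context: Alphabets are finite. A ranked alphabet $\Sigma$ is a finite set of symbols with, for each $k\ge 0$, a subset $\Sigma_k$ (symbols of rank $k$; a symbol may have several ranks), $\Sigma=\bigcup_k\Sigma_k$, only finitely many $\Sigma_k$ nonempty. $T_\Sigma$ is the set of trees over $\Sigma$: $a\in T_\Sigma$ for $a\in\Sigma_0$, and $a[t_1\cdots t_k]\in T_\Sigma$ for $k\ge1$, $a\in\Sigma_k$, $t_i\in T_\Sigma$. A tree transformation from $T_\Sigma$ into $T_\Delta$ is a subset of $T_\Sigma\times T_\Delta$; maps $f:T_\Sigma\to T_\Delta$ are identified with $\{(s,t)\mid f(s)=t\}$ and maps $f:T_\Sigma\to\mathcal P(T_\Delta)$ with $\{(s,t)\mid t\in f(s)\}$. For $M_1\subseteq T_\Sigma\times T_\Delta$ and $M_2\subseteq T_\Delta\times T_\Omega$, $M_1\circ M_2=\{(s,t)\mid (s,u)\in M_1,(u,t)\in M_2\text{ for some }u\}$ ($M_1$ is applied first); $F\circ G=\{M_1\circ M_2\mid M_1\in F,M_2\in G\}$. Variables: $X_k=\{x_1,\dots,x_k\}$, $X_0=\emptyset$; $T_\Delta(X_k)$ is the set of trees over $\Delta\cup X_k$, variables having rank $0$. $REL$: a relabeling is a family of maps $r_k:\Sigma_k\to\mathcal P(\Delta_k)$,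 determining $r:T_\Sigma\to\mathcal P(T_\Delta)$ by $r(a)=r_0(a)$ for $a\in\Sigma_0$, $r(a[t_1\cdots t_k])=\{b[s_1\cdots s_k]\mid b\in r_k(a),s_i\in r(t_i)\}$. $FTA$: a finite tree automaton restriction is a tree transformation $\{(t,t)\mid t\in L\}$ with $L\subseteq T_\Sigma$ recognizable, i.e. $L=\{t\in T_\Sigma\mid\widehat\delta(t)\in F\}$ for some finite set $Q$, $F\subseteq Q$, states $s_a\in Q$ ($a\in\Sigma_0$) and maps $\delta_a^k:Q^k\to Q$ ($k\ge1,a\in\Sigma_k$), where $\widehat\delta(a)=s_a$, $\widehat\delta(a[t_1\cdots t_k])=\delta_a^k(\widehat\delta(t_1),\dots,\widehat\delta(t_k))$. $HOM$, $LHOM$: a tree homomorphism is a family of maps $h_k:\Sigma_k\to T_\Delta(X_k)$, determining $h:T_\Sigma\to T_\Delta$ by $h(a)=h_0(a)$ and $h(a[t_1\cdots t_k])=h_k(a)\langle x_1\gets h(t_1),\dots,x_k\gets h(t_k)\rangle$ (simultaneous substitution). It is linear if no $h_k(a)$ contains a variable twice. A bottom-up finite tree transducer is $M=(Q,\Sigma,\Delta,R,Q_d)$, where $Q$ is a finite set of states, regarded as symbols of rank $1$ only and disjoint from $\Sigma\cup\Delta$, $Q_d\subseteq Q$ (final states), and $R$ is a finite set of rules of the forms $a\to q[t]$ ($a\in\Sigma_0$, $q\in Q$, $t\in T_\Delta$) or $a[q_1[x_1]\cdots q_k[x_k]]\to q[t]$ ($k\ge1$, $a\in\Sigma_k$,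 $q_i,q\in Q$, $t\in T_\Delta(X_k)$). Rules rewrite trees over $Q\cup\Sigma\cup\Delta$: $s\Rightarrow s'$ if $s'$ is obtained from $s$ by replacing one occurrence of a subtree $v\langle x_1\gets\phi_1,\dots,x_k\gets\phi_k\rangle$ by $w\langle x_1\gets\phi_1,\dots,x_k\gets\phi_k\rangle$ for a rule $v\to w$ and some $\phi_i\in T_\Delta$. $M$ realizes $\{(s,t)\in T_\Sigma\times T_\Delta\mid s\Rightarrow^*q[t]\text{ for some }q\in Q_d\}$. $M$ is linear if no variable occurs more than once in the right hand side of a rule. $B$, $LB$: classes of tree transformations realized by arbitrary, resp. linear, bottom-up finite tree transducers. *)

theory Defs
  imports Main
begin

section \<open>Trees over ranked alphabets\<close>

text \<open>
  A ranked alphabet is given by the family of its symbol sets of rank k. The sets need not be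
  disjoint: a symbol may have several ranks.
\<close>

type_synonym 'a ranked = "nat \<Rightarrow> 'a set"

definition ranked_alphabet :: "'a ranked \<Rightarrow> bool" where
  "ranked_alphabet \<Sigma> \<longleftrightarrow> finite (\<Union>k. \<Sigma> k) \<and> finite {k. \<Sigma> k \<noteq> {}}"

text \<open>The tree consisting of a single symbol a of rank 0 is \<open>Node a []\<close>.\<close>

datatype 'a tree = Node 'a "'a tree list"

inductive_set trees :: "'a ranked \<Rightarrow> 'a tree set" for \<Sigma> :: "'a ranked" where
  "a \<in> \<Sigma> (length ts) \<Longrightarrow> (\<And>t. t \<in> set ts \<Longrightarrow> t \<in> trees \<Sigma>) \<Longrightarrow> Node a ts \<in> trees \<Sigma>"

text \<open>
  Trees with variables. Variables are counted from 0: \<open>Var i\<close> is the variable written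
  \<open>x\<close> with index \<open>i + 1\<close> on paper, so that \<open>vtrees \<Sigma> k\<close> is the set of trees over the
  symbols of \<open>\<Sigma>\<close> and the first \<open>k\<close> variables.
\<close>

datatype 'a vtree = Var nat | VNode 'a "'a vtree list"

inductive_set vtrees :: "'a ranked \<Rightarrow> nat \<Rightarrow> 'a vtree set"
  for \<Sigma> :: "'a ranked" and k :: nat where
  "i < k \<Longrightarrow> Var i \<in> vtrees \<Sigma> k"
| "a \<in> \<Sigma> (length ts) \<Longrightarrow> (\<And>t. t \<in> set ts \<Longrightarrow> t \<in> vtrees \<Sigma> k) \<Longrightarrow> VNode a ts \<in> vtrees \<Sigma> k"

primrec subst :: "(nat \<Rightarrow> 'a tree) \<Rightarrow> 'a vtree \<Rightarrow> 'a tree" where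
  "subst \<phi> (Var i) = \<phi> i"
| "subst \<phi> (VNode a ts) = Node a (map (subst \<phi>) ts)"

primrec var_occs :: "'a vtree \<Rightarrow> nat list" where
  "var_occs (Var i) = [i]"
| "var_occs (VNode a ts) = concat (map var_occs ts)"

definition linear_vtree :: "'a vtree \<Rightarrow> bool" where
  "linear_vtree t \<longleftrightarrow> distinct (var_occs t)"

section \<open>Classes of tree transformations\<close>

text \<open>
  A tree transformation is recorded together with its source and target alphabets, so that two
  transformations are composed only if the target alphabet of the first is the source alphabet
  of the second. The relational composition \<open>M1 O M2\<close> applies \<open>M1\<close> first.
\<close>

type_synonym ('a, 'b) transf = "'a ranked \<times> ('a tree \<times> 'b tree) set \<times> 'b ranked"

definition class_comp ::
    "('a, 'b) transf set \<Rightarrow> ('b, 'c) transf set \<Rightarrow> ('a, 'c) transf set"  (infixl "\<odot>" 75) where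
  "F \<odot> G = {(\<Sigma>, M1 O M2, \<Omega>) | \<Sigma> M1 \<Delta> M2 \<Omega>. (\<Sigma>, M1, \<Delta>) \<in> F \<and> (\<Delta>, M2, \<Omega>) \<in> G}"

subsection \<open>Relabelings\<close>

definition relabeling :: "'a ranked \<Rightarrow> 'b ranked \<Rightarrow> (nat \<Rightarrow> 'a \<Rightarrow> 'b set) \<Rightarrow> bool" where
  "relabeling \<Sigma> \<Delta> r \<longleftrightarrow> (\<forall>k. \<forall>a \<in> \<Sigma> k. r k a \<subseteq> \<Delta> k)"

primrec relabel :: "(nat \<Rightarrow> 'a \<Rightarrow> 'b set) \<Rightarrow> 'a tree \<Rightarrow> 'b tree set" where
  "relabel r (Node a ts) =
     {Node b ss | b ss. b \<in> r (length ts) a \<and> list_all2 (\<in>) ss (map (relabel r) ts)}"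

definition REL :: "('a, 'b) transf set" where
  "REL = {(\<Sigma>, {(s, t). s \<in> trees \<Sigma> \<and> t \<in> relabel r s}, \<Delta>) | \<Sigma> r \<Delta>.
            ranked_alphabet \<Sigma> \<and> ranked_alphabet \<Delta> \<and> relabeling \<Sigma> \<Delta> r}"

subsection \<open>Finite tree automaton restrictions\<close>

text \<open>
  The transition map \<open>\<delta> a\<close> acts on the list of the states reached at the direct subtrees; on
  lists of length k it is the transition map for a as a symbol of rank k, and \<open>\<delta> a []\<close> is the
  state assigned to a symbol a of rank 0. The set of states is a finite subset of the type
  argument; for FTAs, and likewise for intermediate alphabets in compositions, the type \<open>nat\<close>
  is no restriction, by finiteness.
\<close>

primrec fta_run :: "('a \<Rightarrow> 'q list \<Rightarrow> 'q) \<Rightarrow> 'a tree \<Rightarrow> 'q" where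
  "fta_run \<delta> (Node a ts) = \<delta> a (map (fta_run \<delta>) ts)"

definition recognizable :: "'q itself \<Rightarrow> 'a ranked \<Rightarrow> 'a tree set \<Rightarrow> bool" where
  "recognizable _ \<Sigma> L \<longleftrightarrow>
     (\<exists>(Q :: 'q set) F \<delta>. finite Q \<and> F \<subseteq> Q \<and>
        (\<forall>k. \<forall>a \<in> \<Sigma> k. \<forall>qs. length qs = k \<and> set qs \<subseteq> Q \<longrightarrow> \<delta> a qs \<in> Q) \<and>
        L = {t \<in> trees \<Sigma>. fta_run \<delta> t \<in> F})"

definition FTA :: "'q itself \<Rightarrow> ('a, 'a) transf set" where
  "FTA q = {(\<Sigma>, {(t, t) | t. t \<in> L}, \<Sigma>) | \<Sigma> L. ranked_alphabet \<Sigma> \<and> recognizable q \<Sigma> L}"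

subsection \<open>Tree homomorphisms\<close>

definition tree_hom :: "'a ranked \<Rightarrow> 'b ranked \<Rightarrow> (nat \<Rightarrow> 'a \<Rightarrow> 'b vtree) \<Rightarrow> bool" where
  "tree_hom \<Sigma> \<Delta> h \<longleftrightarrow> (\<forall>k. \<forall>a \<in> \<Sigma> k. h k a \<in> vtrees \<Delta> k)"

definition linear_tree_hom :: "'a ranked \<Rightarrow> (nat \<Rightarrow> 'a \<Rightarrow> 'b vtree) \<Rightarrow> bool" where
  "linear_tree_hom \<Sigma> h \<longleftrightarrow> (\<forall>k. \<forall>a \<in> \<Sigma> k. linear_vtree (h k a))"

primrec hom_apply :: "(nat \<Rightarrow> 'a \<Rightarrow> 'b vtree) \<Rightarrow> 'a tree \<Rightarrow> 'b tree" where
  "hom_apply h (Node a ts) = subst (\<lambda>i. map (hom_apply h) ts ! i) (h (length ts) a)"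

definition HOM :: "('a, 'b) transf set" where
  "HOM = {(\<Sigma>, {(s, t). s \<in> trees \<Sigma> \<and> hom_apply h s = t}, \<Delta>) | \<Sigma> h \<Delta>.
            ranked_alphabet \<Sigma> \<and> ranked_alphabet \<Delta> \<and> tree_hom \<Sigma> \<Delta> h}"

definition LHOM :: "('a, 'b) transf set" where
  "LHOM = {(\<Sigma>, {(s, t). s \<in> trees \<Sigma> \<and> hom_apply h s = t}, \<Delta>) | \<Sigma> h \<Delta>.
             ranked_alphabet \<Sigma> \<and> ranked_alphabet \<Delta> \<and> tree_hom \<Sigma> \<Delta> h \<and> linear_tree_hom \<Sigma> h}"

subsection \<open>Bottom-up finite tree transducers\<close>

text \<open>
  \<open>Rule a [q1, ..., qk] q t\<close> stands for the rule \<open>a[q1[x1] ... qk[xk]] \<rightarrow> q[t]\<close>, which for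
  \<open>k = 0\<close> reads \<open>a \<rightarrow> q[t]\<close>. The input and output alphabets use the same type of symbols and
  may overlap. Sentential forms are trees over \<open>'q + 's\<close>: the left summand holds the states,
  which are thereby disjoint from the symbols of both alphabets.
\<close>

datatype ('q, 's) rule =
  Rule (rule_sym: 's) (rule_args: "'q list") (rule_target: 'q) (rule_out: "'s vtree")

record ('q, 's) bu_transducer =
  states :: "'q set"
  in_alph :: "'s ranked"
  out_alph :: "'s ranked"
  rules :: "('q, 's) rule set"
  final_states :: "'q set"

definition bu_transducer :: "('q, 's) bu_transducer \<Rightarrow> bool" where
  "bu_transducer M \<longleftrightarrow>
     finite (states M) \<and> ranked_alphabet (in_alph M) \<and> ranked_alphabet (out_alph M) \<and>
     final_states M \<subseteq> states M \<and> finite (rules M) \<and>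
     (\<forall>\<rho> \<in> rules M. rule_sym \<rho> \<in> in_alph M (length (rule_args \<rho>)) \<and>
        set (rule_args \<rho>) \<subseteq> states M \<and> rule_target \<rho> \<in> states M \<and>
        rule_out \<rho> \<in> vtrees (out_alph M) (length (rule_args \<rho>)))"

definition linear_transducer :: "('q, 's) bu_transducer \<Rightarrow> bool" where
  "linear_transducer M \<longleftrightarrow> (\<forall>\<rho> \<in> rules M. linear_vtree (rule_out \<rho>))"

definition lhs :: "('q, 's) rule \<Rightarrow> ('q + 's) vtree" where
  "lhs \<rho> = VNode (Inr (rule_sym \<rho>))
     (map (\<lambda>i. VNode (Inl (rule_args \<rho> ! i)) [Var i]) [0..<length (rule_args \<rho>)])"

definition rhs :: "('q, 's) rule \<Rightarrow> ('q + 's) vtree" where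
  "rhs \<rho> = VNode (Inl (rule_target \<rho>)) [map_vtree Inr (rule_out \<rho>)]"

inductive step :: "('q, 's) bu_transducer \<Rightarrow> ('q + 's) tree \<Rightarrow> ('q + 's) tree \<Rightarrow> bool"
  for M :: "('q, 's) bu_transducer" where
  "\<rho> \<in> rules M \<Longrightarrow> (\<And>i. i < length (rule_args \<rho>) \<Longrightarrow> \<phi> i \<in> trees (out_alph M)) \<Longrightarrow>
     step M (subst (\<lambda>i. map_tree Inr (\<phi> i)) (lhs \<rho>)) (subst (\<lambda>i. map_tree Inr (\<phi> i)) (rhs \<rho>))"
| "step M s s' \<Longrightarrow> step M (Node f (us @ s # vs)) (Node f (us @ s' # vs))"

definition realized :: "('q, 's) bu_transducer \<Rightarrow> ('s tree \<times> 's tree) set" where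
  "realized M = {(s, t). s \<in> trees (in_alph M) \<and> t \<in> trees (out_alph M) \<and>
     (\<exists>q \<in> final_states M. (step M)\<^sup>*\<^sup>* (map_tree Inr s) (Node (Inl q) [map_tree Inr t]))}"

definition B :: "'q itself \<Rightarrow> ('s, 's) transf set" where
  "B _ = {(in_alph M, realized M, out_alph M) | M :: ('q, 's) bu_transducer. bu_transducer M}"

definition LB :: "'q itself \<Rightarrow> ('s, 's) transf set" where
  "LB _ = {(in_alph M, realized M, out_alph M) | M :: ('q, 's) bu_transducer.
             bu_transducer M \<and> linear_transducer M}"

end

theory Submission imports Defs begin

text \<open>
  The relabeling nondeterministically guesses, at every node of the input tree, the rule that the
  transducer applies there; the intermediate alphabet consists of (codes of) the rules. The
  automaton checks that the guessed rules fit together and end in a final state, and the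
  homomorphism sends every rule to its right hand side.
\<close>

section \<open>Evaluation of sentential forms\<close>

lemma subst_in_trees:
  "v \<in> vtrees \<Delta> k \<Longrightarrow> (\<And>i. i < k \<Longrightarrow> \<phi> i \<in> trees \<Delta>) \<Longrightarrow> subst \<phi> v \<in> trees \<Delta>"
  by (induction rule: vtrees.induct) (auto intro!: trees.intros)

lemma subst_cong_vtrees:
  "v \<in> vtrees \<Delta> k \<Longrightarrow> (\<And>i. i < k \<Longrightarrow> \<phi> i = \<psi> i) \<Longrightarrow> subst \<phi> v = subst \<psi> v"
  by (induction rule: vtrees.induct) auto

lemma map_tree_subst: "map_tree f (subst \<phi> v) = subst (\<lambda>i. map_tree f (\<phi> i)) (map_vtree f v)"
  by (induction v) auto

lemma inj_map_tree_Inr: "map_tree Inr s = map_tree Inr t \<longleftrightarrow> s = t"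
  by (metis inj_Inr injD tree.inj_map)

lemma subst_lhs:
  "subst \<psi> (lhs \<rho>) =
     Node (Inr (rule_sym \<rho>))
       (map (\<lambda>i. Node (Inl (rule_args \<rho> ! i)) [\<psi> i]) [0..<length (rule_args \<rho>)])"
  by (simp add: lhs_def)

lemma subst_rhs:
  "subst (\<lambda>i. map_tree Inr (\<phi> i)) (rhs \<rho>) =
     Node (Inl (rule_target \<rho>)) [map_tree Inr (subst \<phi> (rule_out \<rho>))]"
  by (simp add: rhs_def map_tree_subst)

text \<open>Big-step semantics: the form derives \<open>q[t]\<close>. The rule
  \<open>evaluated\<close> covers forms that already have a state on top, so that the relation also
  speaks of intermediate sentential forms and can be traced backward along steps.\<close>

inductive evaluates ::
    "('q, 's) bu_transducer \<Rightarrow> ('q + 's) tree \<Rightarrow> 'q \<Rightarrow> 's tree \<Rightarrow> bool"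
  for M :: "('q, 's) bu_transducer" where
  evaluated: "t \<in> trees (out_alph M) \<Longrightarrow> evaluates M (Node (Inl q) [map_tree Inr t]) q t"
| apply_rule:
    "\<rho> \<in> rules M \<Longrightarrow> length us = length (rule_args \<rho>) \<Longrightarrow>
     (\<And>i. i < length us \<Longrightarrow> evaluates M (us ! i) (rule_args \<rho> ! i) (\<phi> i)) \<Longrightarrow>
     evaluates M (Node (Inr (rule_sym \<rho>)) us) (rule_target \<rho>) (subst \<phi> (rule_out \<rho>))"

inductive_cases evaluates_InlE: "evaluates M (Node (Inl p) us) q t"
inductive_cases evaluates_InrE: "evaluates M (Node (Inr a) us) q t"

lemma evaluates_out_trees:
  assumes "bu_transducer M" "evaluates M u q t"
  shows "t \<in> trees (out_alph M)"
  using assms(2)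
proof (induction rule: evaluates.induct)
  case (apply_rule \<rho> us \<phi>)
  then show ?case
    using assms(1) by (auto simp: bu_transducer_def intro!: subst_in_trees)
qed

text \<open>Every right hand side has a state at its root, and rewriting in a context keeps that
  state in the tree.\<close>

lemma step_result_not_state_free: "step M u u' \<Longrightarrow> u' \<noteq> map_tree Inr t"
proof (induction arbitrary: t rule: step.induct)
  case (1 \<rho> \<phi>)
  then show ?case by (cases t) (simp add: subst_rhs)
next
  case (2 s s' f us vs)
  show ?case
  proof
    assume "Node f (us @ s' # vs) = map_tree Inr t"
    then obtain b ts where "us @ s' # vs = map (map_tree Inr) ts"
      by (cases t) auto
    then have "s' \<in> set (map (map_tree Inr) ts)"
      by (metis in_set_conv_decomp)
    then show False using 2 by auto
  qed
qed

text \<open>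
  The alphabets may overlap, so a rule may also be applied inside an output tree below a state.
  Such a step creates nested states, which can never disappear again; such forms do not evaluate.
\<close>

lemma evaluates_step_backward:
  "step M u u' \<Longrightarrow> evaluates M u' q t \<Longrightarrow> evaluates M u q t"
proof (induction arbitrary: q t rule: step.induct)
  case (1 \<rho> \<phi>)
  \<comment> \<open>A form with a state at its root evaluates only by \<open>evaluated\<close>, so
    state and output can be read off.\<close>
  then have "q = rule_target \<rho>" "t = subst \<phi> (rule_out \<rho>)"
    by (auto simp: subst_rhs inj_map_tree_Inr elim!: evaluates_InlE)
  then show ?case
    using 1 by (auto simp: subst_lhs intro!: apply_rule evaluated)
next
  case (2 s s' f us vs)
  show ?case
  proof (cases f)
    case (Inl p)
    then have "s' = map_tree Inr t"
      using 2(3) by (auto simp: append_eq_Cons_conv elim!: evaluates_InlE)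
    then show ?thesis
      using step_result_not_state_free[OF 2(1)] by blast
  next
    case (Inr a)
    with 2(3) obtain \<rho> \<phi> where \<rho>: "\<rho> \<in> rules M" "a = rule_sym \<rho>" "q = rule_target \<rho>"
        "t = subst \<phi> (rule_out \<rho>)" "length (us @ s' # vs) = length (rule_args \<rho>)"
      and ev: "\<And>i. i < length (us @ s' # vs) \<Longrightarrow>
        evaluates M ((us @ s' # vs) ! i) (rule_args \<rho> ! i) (\<phi> i)"
      by (auto elim!: evaluates_InrE)
    \<comment> \<open>Only the child at position \<open>length us\<close> changes, and the induction
      hypothesis handles it.\<close>
    have "evaluates M ((us @ s # vs) ! i) (rule_args \<rho> ! i) (\<phi> i)"
      if "i < length (us @ s # vs)" for i
      using ev[of i] that 2(2) by (cases "i = length us") (auto simp: nth_append nth_Cons')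
    then show ?thesis
      using \<rho> Inr by (auto intro!: apply_rule)
  qed
qed

section \<open>Agreement of evaluation and derivation\<close>

lemma steps_pointwise:
  assumes "list_all2 (step M)\<^sup>*\<^sup>* us us'"
  shows "(step M)\<^sup>*\<^sup>* (Node f us) (Node f us')"
proof -
  \<comment> \<open>Children are rewritten from left to right; the prefix \<open>ws\<close> holds
    those already finished.\<close>
  have "(step M)\<^sup>*\<^sup>* (Node f (ws @ us)) (Node f (ws @ us'))" for ws
    using assms
  proof (induction arbitrary: ws rule: list_all2_induct)
    case (Cons u us u' us')
    from Cons(1) have "(step M)\<^sup>*\<^sup>* (Node f (ws @ u # us)) (Node f (ws @ u' # us))"
      by (induction rule: rtranclp_induct) (auto intro: step.intros rtranclp.rtrancl_into_rtrancl)
    with Cons(3)[of "ws @ [u']"] show ?case by simp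
  qed simp
  from this[of "[]"] show ?thesis by simp
qed

text \<open>First all children are derived to their forms \<open>q_i[t_i]\<close>, which yields an
  instance of the left hand side; then one rule application finishes.\<close>

lemma evaluates_imp_steps:
  assumes "bu_transducer M" "evaluates M u q t"
  shows "(step M)\<^sup>*\<^sup>* u (Node (Inl q) [map_tree Inr t])"
  using assms(2)
proof (induction rule: evaluates.induct)
  case (apply_rule \<rho> us \<phi>)
  have "(step M)\<^sup>*\<^sup>* (Node (Inr (rule_sym \<rho>)) us) (subst (\<lambda>i. map_tree Inr (\<phi> i)) (lhs \<rho>))"
    unfolding subst_lhs using apply_rule
    by (intro steps_pointwise) (simp add: list_all2_conv_all_nth)
  moreover have "step M (subst (\<lambda>i. map_tree Inr (\<phi> i)) (lhs \<rho>))
      (subst (\<lambda>i. map_tree Inr (\<phi> i)) (rhs \<rho>))"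
    using apply_rule by (auto intro!: step.intros(1) intro: evaluates_out_trees[OF assms(1)])
  ultimately show ?case by (simp add: subst_rhs)
qed simp

text \<open>A derivation ends in a form that evaluates by \<open>evaluated\<close>, and evaluation
  is pulled back along its steps; the converse is \<open>evaluates_imp_steps\<close>.\<close>

lemma realized_iff_evaluates:
  assumes "bu_transducer M"
  shows "(s, t) \<in> realized M \<longleftrightarrow>
    s \<in> trees (in_alph M) \<and> (\<exists>q \<in> final_states M. evaluates M (map_tree Inr s) q t)"
proof -
  have "evaluates M u q t"
    if "(step M)\<^sup>*\<^sup>* u (Node (Inl q) [map_tree Inr t])" "t \<in> trees (out_alph M)" for u q
    using that
    by (induction rule: converse_rtranclp_induct)
      (auto intro: evaluated evaluates_step_backward)
  then show ?thesis
    using evaluates_imp_steps[OF assms] evaluates_out_trees[OF assms]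
    unfolding realized_def by blast
qed

section \<open>Guessing and checking rules\<close>

lemma relabel_in_trees:
  assumes "relabeling \<Sigma> \<Delta> r"
  shows "s \<in> trees \<Sigma> \<Longrightarrow> w \<in> relabel r s \<Longrightarrow> w \<in> trees \<Delta>"
proof (induction s arbitrary: w rule: trees.induct)
  case (1 a ts)
  then obtain b ws where w: "w = Node b ws" "b \<in> r (length ts) a"
      "length ws = length ts" "\<And>i. i < length ts \<Longrightarrow> ws ! i \<in> relabel r (ts ! i)"
    by (auto simp: list_all2_conv_all_nth)
  have "b \<in> \<Delta> (length ws)"
    using assms 1(1) w(2,3) by (auto simp: relabeling_def)
  moreover have "v \<in> trees \<Delta>" if "v \<in> set ws" for v
    using that 1(3) w(3,4) by (metis in_set_conv_nth nth_mem)
  ultimately show ?case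
    using w(1) by (auto intro: trees.intros)
qed

lemma class_compI:
  "(\<Sigma>, M1, \<Delta>) \<in> F \<Longrightarrow> (\<Delta>, M2, \<Omega>) \<in> G \<Longrightarrow> (\<Sigma>, M1 O M2, \<Omega>) \<in> F \<odot> G"
  by (auto simp: class_comp_def)

text \<open>Rules and states are coded as natural numbers because the intermediate alphabet and the
  automaton states have type \<open>nat\<close>.\<close>

locale coded_transducer =
  fixes M :: "('q, 's) bu_transducer"
    and rule_code :: "('q, 's) rule \<Rightarrow> nat" and state_code :: "'q \<Rightarrow> nat"
  assumes transducer: "bu_transducer M"
    and inj_rule_code: "inj_on rule_code (rules M)"
    and inj_state_code: "inj_on state_code (states M)"
begin

definition decode :: "nat \<Rightarrow> ('q, 's) rule" where
  "decode = inv_into (rules M) rule_code"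

definition rule_alph :: "nat ranked" where
  "rule_alph k = rule_code ` {\<rho> \<in> rules M. length (rule_args \<rho>) = k}"

definition guess :: "nat \<Rightarrow> 's \<Rightarrow> nat set" where
  "guess k a = rule_code ` {\<rho> \<in> rules M. rule_sym \<rho> = a \<and> length (rule_args \<rho>) = k}"

text \<open>The state \<open>0\<close> is a sink, reached when the rules of a tree do not fit together.\<close>

definition transition :: "nat \<Rightarrow> nat list \<Rightarrow> nat" where
  "transition n qs =
     (if qs = map (Suc \<circ> state_code) (rule_args (decode n))
      then Suc (state_code (rule_target (decode n))) else 0)"

definition out_hom :: "nat \<Rightarrow> nat \<Rightarrow> 's vtree" where
  "out_hom k n = rule_out (decode n)"

lemma decode_rule_code [simp]: "\<rho> \<in> rules M \<Longrightarrow> decode (rule_code \<rho>) = \<rho>"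
  by (simp add: decode_def inj_rule_code)

lemma transition_rule_code:
  "\<rho> \<in> rules M \<Longrightarrow> transition (rule_code \<rho>) qs =
     (if qs = map (Suc \<circ> state_code) (rule_args \<rho>) then Suc (state_code (rule_target \<rho>)) else 0)"
  by (simp add: transition_def)

lemma out_hom_rule_code: "\<rho> \<in> rules M \<Longrightarrow> out_hom k (rule_code \<rho>) = rule_out \<rho>"
  by (simp add: out_hom_def)

lemma rule_wf:
  assumes "\<rho> \<in> rules M"
  shows "rule_sym \<rho> \<in> in_alph M (length (rule_args \<rho>))" "set (rule_args \<rho>) \<subseteq> states M"
    "rule_target \<rho> \<in> states M" "rule_out \<rho> \<in> vtrees (out_alph M) (length (rule_args \<rho>))"
  using assms transducer by (auto simp: bu_transducer_def)

lemma mem_guess_iff: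
  "n \<in> guess k a \<longleftrightarrow>
     (\<exists>\<rho> \<in> rules M. n = rule_code \<rho> \<and> rule_sym \<rho> = a \<and> length (rule_args \<rho>) = k)"
  by (auto simp: guess_def)

section \<open>Well-formedness of relabeling, homomorphism and automaton\<close>

lemma ranked_alphabet_rule_alph: "ranked_alphabet rule_alph"
proof -
  have "finite (rules M)"
    using transducer by (simp add: bu_transducer_def)
  moreover have "(\<Union>k. rule_alph k) \<subseteq> rule_code ` rules M"
    and "{k. rule_alph k \<noteq> {}} \<subseteq> (\<lambda>\<rho>. length (rule_args \<rho>)) ` rules M"
    by (auto simp: rule_alph_def)
  ultimately show ?thesis
    unfolding ranked_alphabet_def by (meson finite_imageI finite_subset)
qed

lemma relabeling_guess: "relabeling (in_alph M) rule_alph guess"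
  by (auto simp: relabeling_def guess_def rule_alph_def)

lemma tree_hom_out_hom: "tree_hom rule_alph (out_alph M) out_hom"
  using rule_wf by (auto simp: tree_hom_def out_hom_def rule_alph_def)

lemma linear_tree_hom_out_hom: "linear_transducer M \<Longrightarrow> linear_tree_hom rule_alph out_hom"
  by (auto simp: linear_tree_hom_def linear_transducer_def out_hom_def rule_alph_def)

text \<open>These are the successful computations of the transducer, written as trees of coded
  rules.\<close>

definition accepted :: "nat tree set" where
  "accepted =
     {w \<in> trees rule_alph. fta_run transition w \<in> (Suc \<circ> state_code) ` final_states M}"

lemma recognizable_accepted: "recognizable TYPE(nat) rule_alph accepted"
  unfolding recognizable_def
proof (intro exI conjI)
  \<comment> \<open>\<open>Suc\<close> keeps the codes of genuine states apart from the sink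
    \<open>0\<close>.\<close>
  show "finite (insert 0 ((Suc \<circ> state_code) ` states M))"
    using transducer by (simp add: bu_transducer_def)
  show "(Suc \<circ> state_code) ` final_states M \<subseteq> insert 0 ((Suc \<circ> state_code) ` states M)"
    using transducer by (auto simp: bu_transducer_def)
  show "\<forall>k. \<forall>a \<in> rule_alph k. \<forall>qs. length qs = k \<and>
      set qs \<subseteq> insert 0 ((Suc \<circ> state_code) ` states M) \<longrightarrow>
      transition a qs \<in> insert 0 ((Suc \<circ> state_code) ` states M)"
    using rule_wf(3) by (auto simp: rule_alph_def transition_def)
qed (rule accepted_def)

section \<open>Evaluations as trees of rules\<close>

text \<open>An input tree has no state at its root, so its evaluation ends with
  \<open>apply_rule\<close>; the code of that rule labels the root of \<open>w\<close>.\<close>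

lemma evaluates_imp_guess:
  "evaluates M (map_tree Inr s) q t \<Longrightarrow>
     \<exists>w \<in> relabel guess s. fta_run transition w = Suc (state_code q) \<and> hom_apply out_hom w = t"
proof (induction s arbitrary: q t)
  case (Node a ts)
  then obtain \<rho> \<phi> where \<rho>: "\<rho> \<in> rules M" "a = rule_sym \<rho>" "q = rule_target \<rho>"
      "t = subst \<phi> (rule_out \<rho>)" "length ts = length (rule_args \<rho>)"
    and ev: "\<And>i. i < length ts \<Longrightarrow> evaluates M (map_tree Inr (ts ! i)) (rule_args \<rho> ! i) (\<phi> i)"
    by (auto elim!: evaluates_InrE)
  have "\<forall>i<length ts. \<exists>w. w \<in> relabel guess (ts ! i) \<and>
      fta_run transition w = Suc (state_code (rule_args \<rho> ! i)) \<and> hom_apply out_hom w = \<phi> i"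
    using Node.IH[OF nth_mem ev] by blast
  then obtain ws where ws: "\<And>i. i < length ts \<Longrightarrow> ws i \<in> relabel guess (ts ! i) \<and>
      fta_run transition (ws i) = Suc (state_code (rule_args \<rho> ! i)) \<and>
      hom_apply out_hom (ws i) = \<phi> i"
    by metis
  let ?w = "Node (rule_code \<rho>) (map ws [0..<length ts])"
  have "?w \<in> relabel guess (Node a ts)"
    using \<rho> ws by (auto simp: guess_def list_all2_conv_all_nth)
  moreover have "map (fta_run transition) (map ws [0..<length ts]) =
      map (Suc \<circ> state_code) (rule_args \<rho>)"
    using \<rho> ws by (auto intro!: nth_equalityI)
  then have "fta_run transition ?w = Suc (state_code q)"
    using \<rho> by (simp add: transition_rule_code)
  \<comment> \<open>The two substitutions are known to agree only below the rank of the rule, which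
    covers all variables of its right hand side.\<close>
  moreover have "hom_apply out_hom ?w = t"
    using \<rho> ws by (auto simp: out_hom_rule_code intro!: subst_cong_vtrees[OF rule_wf(4)])
  ultimately show ?case by blast
qed

text \<open>A nonzero run excludes the sink, so the states at the children are exactly those the
  root rule expects, and the induction hypothesis applies to them.\<close>

lemma guess_imp_evaluates:
  "w \<in> relabel guess s \<Longrightarrow> fta_run transition w = Suc (state_code q) \<Longrightarrow> q \<in> states M \<Longrightarrow>
     evaluates M (map_tree Inr s) q (hom_apply out_hom w)"
proof (induction s arbitrary: q w)
  case (Node a ts)
  then obtain \<rho> ws where w: "w = Node (rule_code \<rho>) ws" "\<rho> \<in> rules M" "a = rule_sym \<rho>"
      "length (rule_args \<rho>) = length ts" "list_all2 (\<in>) ws (map (relabel guess) ts)"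
    by (auto simp: mem_guess_iff)
  with Node.prems(2) have run: "map (fta_run transition) ws = map (Suc \<circ> state_code) (rule_args \<rho>)"
    and "state_code (rule_target \<rho>) = state_code q"
    by (auto simp: transition_rule_code split: if_splits)
  \<comment> \<open>\<open>state_code\<close> is injective only on \<open>states M\<close>, hence
    the premise on \<open>q\<close>.\<close>
  then have q: "q = rule_target \<rho>"
    using inj_state_code Node.prems(3) w(2) rule_wf(3) by (auto dest: inj_onD)
  have "evaluates M (map_tree Inr (ts ! i)) (rule_args \<rho> ! i) (map (hom_apply out_hom) ws ! i)"
    if "i < length ts" for i
  proof -
    have "fta_run transition (ws ! i) = Suc (state_code (rule_args \<rho> ! i))"
      using arg_cong[OF run, of "\<lambda>xs. xs ! i"] that w(4,5) by (simp add: list_all2_lengthD)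
    moreover have "rule_args \<rho> ! i \<in> states M"
      using rule_wf(2)[OF w(2)] that w(4) by auto
    ultimately show ?thesis
      using Node.IH[of "ts ! i" "ws ! i"] that w(5) by (auto simp: list_all2_conv_all_nth)
  qed
  then show ?case
    using w q by (auto simp: out_hom_rule_code intro!: apply_rule)
qed

section \<open>The decomposition and its classes\<close>

lemma realized_decomposition:
  "realized M =
     {(s, w). s \<in> trees (in_alph M) \<and> w \<in> relabel guess s} O {(w, w) | w. w \<in> accepted} O
     {(w, t). w \<in> trees rule_alph \<and> hom_apply out_hom w = t}" (is "_ = ?C")
proof -
  have final: "final_states M \<subseteq> states M"
    using transducer by (simp add: bu_transducer_def)
  have eq: "(s, t) \<in> realized M \<longleftrightarrow> (s, t) \<in> ?C" for s t
  proof -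
    \<comment> \<open>The restriction makes both intermediate trees equal to one \<open>w\<close>,
      and any relabeling of \<open>s\<close> is a tree over \<open>rule_alph\<close>.\<close>
    have "(s, t) \<in> ?C \<longleftrightarrow> s \<in> trees (in_alph M) \<and>
        (\<exists>q \<in> final_states M. \<exists>w \<in> relabel guess s.
           fta_run transition w = Suc (state_code q) \<and> hom_apply out_hom w = t)"
      using relabel_in_trees[OF relabeling_guess] by (auto simp: accepted_def relcomp_unfold)
    also have "\<dots> \<longleftrightarrow> (s, t) \<in> realized M"
      unfolding realized_iff_evaluates[OF transducer]
      using evaluates_imp_guess guess_imp_evaluates final by blast
    finally show ?thesis by blast
  qed
  show ?thesis
    by (intro equalityI subrelI) (simp_all only: eq)
qed

text \<open>The class \<open>H\<close> stays arbitrary so that \<open>HOM\<close> and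
  \<open>LHOM\<close> share the argument.\<close>

lemma in_class_comp:
  assumes "(rule_alph, {(w, t). w \<in> trees rule_alph \<and> hom_apply out_hom w = t}, out_alph M) \<in> H"
  shows "(in_alph M, realized M, out_alph M) \<in> REL \<odot> FTA TYPE(nat) \<odot> H"
proof -
  have "(in_alph M, {(s, w). s \<in> trees (in_alph M) \<and> w \<in> relabel guess s}, rule_alph) \<in> REL"
    using transducer ranked_alphabet_rule_alph relabeling_guess
    by (auto simp: REL_def bu_transducer_def)
  moreover have "(rule_alph, {(w, w) | w. w \<in> accepted}, rule_alph) \<in> FTA TYPE(nat)"
    using ranked_alphabet_rule_alph recognizable_accepted by (auto simp: FTA_def)
  ultimately show ?thesis
    \<comment> \<open>\<open>O\<close> nests to the right but \<open>\<odot>\<close> to the left, so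
      the product is reassociated first.\<close>
    using assms unfolding realized_decomposition O_assoc[symmetric] by (intro class_compI)
qed

lemma in_REL_FTA_HOM:
  "(in_alph M, realized M, out_alph M) \<in> REL \<odot> FTA TYPE(nat) \<odot> (HOM :: (nat, 's) transf set)"
  by (rule in_class_comp)
    (use transducer ranked_alphabet_rule_alph tree_hom_out_hom
      in \<open>auto simp: HOM_def bu_transducer_def\<close>)

lemma in_REL_FTA_LHOM:
  "linear_transducer M \<Longrightarrow>
     (in_alph M, realized M, out_alph M) \<in> REL \<odot> FTA TYPE(nat) \<odot> (LHOM :: (nat, 's) transf set)"
  by (rule in_class_comp)
    (use transducer ranked_alphabet_rule_alph tree_hom_out_hom linear_tree_hom_out_hom
      in \<open>auto simp: LHOM_def bu_transducer_def\<close>)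

end

text \<open>Finite sets inject into the natural numbers.\<close>

lemma coding_exists:
  assumes "bu_transducer M"
  obtains rule_code state_code where "coded_transducer M rule_code state_code"
proof -
  have "finite (rules M)" "finite (states M)"
    using assms by (auto simp: bu_transducer_def)
  then show ?thesis
    using that assms finite_imp_inj_to_nat_seg unfolding coded_transducer_def by metis
qed

theorem theorem4p54:
  "(B TYPE('q) :: ('s, 's) transf set)
     \<subseteq> (REL :: ('s, nat) transf set) \<odot> FTA TYPE(nat) \<odot> (HOM :: (nat, 's) transf set)
   \<and> (LB TYPE('q) :: ('s, 's) transf set)
     \<subseteq> (REL :: ('s, nat) transf set) \<odot> FTA TYPE(nat) \<odot> (LHOM :: (nat, 's) transf set)"
proof (intro conjI subsetI)
  fix \<tau> :: "('s, 's) transf"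
  assume "\<tau> \<in> B TYPE('q)"
  then show "\<tau> \<in> REL \<odot> FTA TYPE(nat) \<odot> (HOM :: (nat, 's) transf set)"
    by (auto simp: B_def elim!: coding_exists intro: coded_transducer.in_REL_FTA_HOM)
next
  fix \<tau> :: "('s, 's) transf"
  assume "\<tau> \<in> LB TYPE('q)"
  then show "\<tau> \<in> REL \<odot> FTA TYPE(nat) \<odot> (LHOM :: (nat, 's) transf set)"
    by (auto simp: LB_def elim!: coding_exists intro: coded_transducer.in_REL_FTA_LHOM)
qed

end
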